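(* Fix $t\in\mathbb{N}$. For any $\epsilon\in(0,1/\sqrt{e})$ there is $n(\epsilon)$ such that for all $n>n(\epsilon)$, every $t$-intersecting family $\mathcal{F}\subseteq\mathcal{M}_{2n}$ with $|\mathcal{F}| > (1-1/\sqrt{e}+\epsilon)(2(n-t)-1)!!$ is contained in a canonically $t$-intersecting family, i.e. there is a set $T$ of $t$ pairwise disjoint edges of $K_{2n}$ with $T\subseteq m$ for every $m\in\mathcal{F}$.
   Context: $\mathcal{M}_{2n}$ is the set of perfect matchings of the complete graph $K_{2n}$. A family $\mathcal{F}\subseteq\mathcal{M}_{2n}$ is $t$-intersecting if $|m\cap m'|\ge t$ for all $m,m'\in\mathcal{F}$. The canonically $t$-intersecting family of a set $T$ of $t$ disjoint edges is $\{m\in\mathcal{M}_{2n}: T\subseteq m\}$. $(2k-1)!!=1\cdot3\cdots(2k-1)$. *)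

theory Defs
  imports "HOL-Analysis.Analysis"
begin

definition edges_K :: "nat \<Rightarrow> nat set set" where
  "edges_K N = {e. \<exists>u v. u < N \<and> v < N \<and> u \<noteq> v \<and> e = {u, v}}"

definition perfect_matchings :: "nat \<Rightarrow> nat set set set" where
  "perfect_matchings n = {m. m \<subseteq> edges_K (2*n)
      \<and> (\<forall>e\<in>m. \<forall>f\<in>m. e \<noteq> f \<longrightarrow> e \<inter> f = {})
      \<and> \<Union>m = {0..<2*n}}"

definition t_intersecting :: "nat \<Rightarrow> nat set set set \<Rightarrow> bool" where
  "t_intersecting t F \<longleftrightarrow> (\<forall>m\<in>F. \<forall>m'\<in>F. card (m \<inter> m') \<ge> t)"

definition odd_dfact :: "nat \<Rightarrow> nat" where
  "odd_dfact k = (\<Prod>i<k. 2*i + 1)"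

end

theory Submission
  imports Defs "HOL-Real_Asymp.Real_Asymp"
begin

text \<open>
  Put R = 3n/2. A subfamily G with core B (all members contain B) is R-spread if every edge outside
  B lies in at most a 1/R fraction of the members of G. As perfect matchings have n < R edges, a
  union bound finds members of two R-spread families which meet only inside the intersection of
  their cores, so the cores of R-spread subfamilies of F are t-intersecting themselves. Conversely,
  enlarging B greedily, any H for which no core of fewer than q edges works has at most
  R^q (2(n-q)-1)!! members; this is negligible for q a small power of n, since fixing a
  further edge divides the number of perfect matchings by almost 2n > R.
  If the cores have no common t-set, they are all covered by q^(t+1) sets of size t+1, which
  makes F too small. Otherwise almost all of F contains a fixed t-set U of edges, and a member of F
  not containing U has to meet all of these outside U; the perfect matchings through U that
  avoid it make up a fraction tending to 1/sqrt e, by inclusion-exclusion.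
\<close>

subsection \<open>Counting perfect matchings\<close>

definition matching :: "'a set set \<Rightarrow> bool" where
  "matching m \<longleftrightarrow> (\<forall>e\<in>m. card e = 2) \<and> pairwise disjnt m"

text \<open>The vertex set is arbitrary rather than an initial segment of the naturals, because
  deleting the endpoints of fixed edges has to stay within the same notion.\<close>

definition matchings_on :: "'a set \<Rightarrow> 'a set set set" where
  "matchings_on V = {m. matching m \<and> \<Union>m = V}"

lemma matching_subset: "matching m \<Longrightarrow> I \<subseteq> m \<Longrightarrow> matching I"
  unfolding matching_def by (meson pairwise_subset subsetD)

lemma finite_matchings_on:
  assumes "finite V" shows "finite (matchings_on V)"
proof (rule finite_subset)
  show "matchings_on V \<subseteq> Pow (Pow V)" by (auto simp: matchings_on_def)
qed (use assms in simp)

lemma finite_matching_on: "finite V \<Longrightarrow> m \<in> matchings_on V \<Longrightarrow> finite m"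
  unfolding matchings_on_def by (auto intro: finite_UnionD)

lemma card_Union_matching:
  assumes "matching I" shows "card (\<Union>I) = 2 * card I"
proof -
  have fin: "finite e" if "e \<in> I" for e
    using assms that unfolding matching_def by (metis card.infinite zero_neq_numeral)
  have "card (\<Union>I) = sum card I"
    using assms fin by (intro card_Union_disjoint) (auto simp: matching_def)
  also have "\<dots> = 2 * card I" using assms by (simp add: matching_def)
  finally show ?thesis .
qed

lemma matching_Un:
  assumes "matching p" "matching I" "\<Union>p \<inter> \<Union>I = {}"
  shows "matching (p \<union> I)"
proof -
  have "disjnt e f" if "e \<in> p" "f \<in> I" for e f
    using assms(3) that by (auto simp: disjnt_def)
  then show ?thesis
    using assms(1,2) unfolding matching_def pairwise_def by (metis Un_iff disjnt_sym)
qed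

text \<open>Deleting \<open>I\<close> inverts the map: the other edges of a perfect matching through
  \<open>I\<close> pair up exactly the vertices that \<open>I\<close> leaves uncovered.\<close>

lemma bij_betw_matchings_containing:
  assumes I: "matching I" "\<Union>I \<subseteq> V"
  shows "bij_betw (\<lambda>p. p \<union> I) (matchings_on (V - \<Union>I)) {m \<in> matchings_on V. I \<subseteq> m}"
proof (rule bij_betw_byWitness[where f' = "\<lambda>m. m - I"])
  show "\<forall>p\<in>matchings_on (V - \<Union>I). (p \<union> I) - I = p"
  proof
    fix p assume p: "p \<in> matchings_on (V - \<Union>I)"
    \<comment> \<open>A common edge would be nonempty and so have an endpoint both inside and
      outside \<open>\<Union>I\<close>.\<close>
    have "e \<notin> I" if "e \<in> p" for e
    proof
      assume "e \<in> I"
      moreover have "e \<noteq> {}" using p that by (auto simp: matchings_on_def matching_def)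
      ultimately show False using p that by (auto simp: matchings_on_def)
    qed
    then show "(p \<union> I) - I = p" by auto
  qed
  show "\<forall>m\<in>{m \<in> matchings_on V. I \<subseteq> m}. (m - I) \<union> I = m" by auto
  show "(\<lambda>p. p \<union> I) ` matchings_on (V - \<Union>I) \<subseteq> {m \<in> matchings_on V. I \<subseteq> m}"
    using I by (auto simp: matchings_on_def intro!: matching_Un)
  show "(\<lambda>m. m - I) ` {m \<in> matchings_on V. I \<subseteq> m} \<subseteq> matchings_on (V - \<Union>I)"
  proof clarify
    fix m assume m: "m \<in> matchings_on V" "I \<subseteq> m"
    have "\<Union>m = V" "pairwise disjnt m"
      using m by (auto simp: matchings_on_def matching_def)
    have "e \<inter> f = {}" if "e \<in> m - I" "f \<in> I" for e f
      using pairwiseD(1)[OF \<open>pairwise disjnt m\<close>, of e f] that m(2) by (auto simp: disjnt_def)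
    then have "\<Union>(m - I) \<inter> \<Union>I = {}" by (simp add: Int_Union2 Int_Union)
    moreover have "\<Union>(m - I) \<union> \<Union>I = \<Union>m" using m(2) by (metis Union_Un_distrib Diff_partition sup_commute)
    ultimately have "\<Union>(m - I) = V - \<Union>I"
      using \<open>\<Union>m = V\<close> by (metis Diff_disjoint Diff_cancel Un_Diff Diff_triv sup_bot_right)
    then show "m - I \<in> matchings_on (V - \<Union>I)"
      using m by (auto simp: matchings_on_def intro: matching_subset)
  qed
qed

lemma card_matchings_containing_eq:
  assumes "matching I" "\<Union>I \<subseteq> V"
  shows "card {m \<in> matchings_on V. I \<subseteq> m} = card (matchings_on (V - \<Union>I))"
  using bij_betw_same_card[OF bij_betw_matchings_containing[OF assms]] by simp

lemma odd_dfact_Suc: "odd_dfact (Suc k) = odd_dfact k * (2 * k + 1)"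
  by (simp add: odd_dfact_def)

lemma odd_dfact_pos: "odd_dfact k > 0"
  by (simp add: odd_dfact_def prod_pos)

text \<open>If \<open>card V = 2 * Suc n\<close>, a fixed vertex \<open>v\<close> has
  \<open>2 * n + 1\<close> possible partners, and deleting both endpoints reduces to
  \<open>n\<close>.\<close>

lemma card_matchings_on:
  assumes "finite V" "card V = 2 * n"
  shows "card (matchings_on V) = odd_dfact n"
  using assms
proof (induction n arbitrary: V)
  case 0
  then have "V = {}" by simp
  then have "matchings_on V = {{}}"
    by (force simp: matchings_on_def matching_def)
  then show ?case by (simp add: odd_dfact_def)
next
  case (Suc n)
  then obtain v where v: "v \<in> V" by fastforce
  let ?P = "\<lambda>u. {m \<in> matchings_on V. {{v, u}} \<subseteq> m}"
  have eq: "matchings_on V = (\<Union>u\<in>V - {v}. ?P u)"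
  proof (intro equalityI subsetI)
    fix m assume m: "m \<in> matchings_on V"
    then obtain e where e: "e \<in> m" "v \<in> e" using v by (auto simp: matchings_on_def)
    then have "card e = 2" using m by (auto simp: matchings_on_def matching_def)
    then obtain u where "e = {v, u}" "u \<noteq> v"
      using e(2) by (auto simp: card_2_iff doubleton_eq_iff)
    then show "m \<in> (\<Union>u\<in>V - {v}. ?P u)"
      using m e by (auto simp: matchings_on_def)
  qed auto
  have "card (matchings_on V) = (\<Sum>u\<in>V - {v}. card (?P u))"
  proof (subst eq, rule card_UN_disjoint)
    show "\<forall>i\<in>V - {v}. \<forall>j\<in>V - {v}. i \<noteq> j \<longrightarrow> ?P i \<inter> ?P j = {}"
    proof (intro ballI impI)
      fix i j assume ij: "i \<in> V - {v}" "j \<in> V - {v}" "i \<noteq> j"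
      have False if "m \<in> ?P i \<inter> ?P j" for m
      proof -
        have "{v,i} \<in> m" "{v,j} \<in> m" "pairwise disjnt m"
          using that by (auto simp: matchings_on_def matching_def)
        moreover have "{v,i} \<noteq> {v,j}" using ij by (auto simp: doubleton_eq_iff)
        ultimately have "disjnt {v,i} {v,j}" by (metis pairwiseD(1))
        then show False by (auto simp: disjnt_def)
      qed
      then show "?P i \<inter> ?P j = {}" by (meson ex_in_conv)
    qed
    show "\<forall>u\<in>V - {v}. finite (?P u)"
      using finite_matchings_on[OF Suc.prems(1)] by simp
    show "finite (V - {v})" using Suc.prems(1) by simp
  qed
  also have "\<dots> = (\<Sum>u\<in>V - {v}. odd_dfact n)"
  proof (rule sum.cong[OF refl])
    fix u assume u: "u \<in> V - {v}"
    have mt: "matching {{v, u}}" using u by (auto simp: matching_def)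
    have "card (?P u) = card (matchings_on (V - \<Union>{{v, u}}))"
      using u v by (intro card_matchings_containing_eq mt) auto
    also have "\<dots> = odd_dfact n"
    proof (rule Suc.IH)
      have "card (V - {v,u}) = card V - card {v,u}"
        using u v by (intro card_Diff_subset) auto
      then show "card (V - \<Union>{{v, u}}) = 2 * n" using u Suc.prems by auto
    qed (use Suc.prems in auto)
    finally show "card (?P u) = odd_dfact n" .
  qed
  also have "\<dots> = odd_dfact (Suc n)"
    using v Suc.prems by (simp add: odd_dfact_Suc)
  finally show ?case .
qed

lemma card_matchings_containing:
  assumes "finite V" "card V = 2 * n" "matching I" "\<Union>I \<subseteq> V"
  shows "card {m \<in> matchings_on V. I \<subseteq> m} = odd_dfact (n - card I)"
proof -
  have "card (V - \<Union>I) = 2 * (n - card I)"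
    using assms card_Union_matching[of I] by (subst card_Diff_subset) (auto intro: finite_subset)
  then show ?thesis
    using assms card_matchings_on[of "V - \<Union>I"] by (simp add: card_matchings_containing_eq)
qed

text \<open>Greedily built sets need not be matchings, so \<open>W\<close> is arbitrary: either no
  perfect matching contains it, or it is a partial matching and the exact count applies.\<close>

lemma card_matchings_containing_le:
  assumes "finite V" "card V = 2 * n"
  shows "card {m \<in> matchings_on V. W \<subseteq> m} \<le> odd_dfact (n - card W)"
proof (cases "{m \<in> matchings_on V. W \<subseteq> m} = {}")
  case False
  then have "matching W" "\<Union>W \<subseteq> V"
    by (auto simp: matchings_on_def intro: matching_subset)
  then show ?thesis using card_matchings_containing[OF assms] by simp
qed (simp only: card.empty)

text \<open>Existence comes from counting: an odd double factorial is positive.\<close>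

lemma matching_extends:
  assumes "finite V" "card V = 2 * n" "matching I" "\<Union>I \<subseteq> V"
  obtains m where "m \<in> matchings_on V" "I \<subseteq> m"
proof -
  have "card {m \<in> matchings_on V. I \<subseteq> m} > 0"
    using card_matchings_containing[OF assms] odd_dfact_pos by simp
  then show ?thesis using that by (auto simp: card_gt_0_iff)
qed

lemma card_perfect_matching:
  assumes "card V = 2 * n" "m \<in> matchings_on V"
  shows "card m = n"
  using assms card_Union_matching[of m] by (simp add: matchings_on_def)

lemma perfect_matchings_eq: "perfect_matchings n = matchings_on {0..<2*n}"
proof -
  have "e \<in> edges_K (2*n)" if "card e = 2" "e \<subseteq> {0..<2*n}" for e
  proof -
    from that(1) obtain u v where "e = {u,v}" "u \<noteq> v" by (auto simp: card_2_iff)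
    with that(2) show ?thesis by (auto simp: edges_K_def)
  qed
  moreover have "card e = 2" if "e \<in> edges_K (2*n)" for e
    using that by (auto simp: edges_K_def)
  ultimately have key: "m \<subseteq> edges_K (2*n) \<longleftrightarrow> (\<forall>e\<in>m. card e = 2)" if "\<Union>m = {0..<2*n}" for m
    using that by (metis Union_upper subset_iff)
  show ?thesis
  proof (rule set_eqI)
    fix m show "m \<in> perfect_matchings n \<longleftrightarrow> m \<in> matchings_on {0..<2*n}"
      by (cases "\<Union>m = {0..<2*n}")
        (simp_all add: perfect_matchings_def matchings_on_def matching_def pairwise_def disjnt_def key)
  qed
qed

subsection \<open>Perfect matchings avoiding a given one\<close>

lemma sum_Pow_alternating:
  assumes "finite A"
  shows "(\<Sum>I\<in>Pow A. (-1) ^ card I) = (if A = {} then 1 else 0 :: real)"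
proof (cases "A = {}")
  case False
  then have "card {x \<in> Pow A. even (card x)} = card {x \<in> Pow A. odd (card x)}"
    using card_subsupersets_even_odd[OF assms, of "{}"] by auto
  then show ?thesis using False assms by (simp add: sum_alternating_cancels)
qed simp

text \<open>The inclusion-exclusion formula for the number of perfect matchings on
  \<open>2 * n\<close> vertices that share no edge with a given one; an analogue of the derangement
  numbers.\<close>

definition derangements :: "nat \<Rightarrow> real" where
  "derangements n = (\<Sum>k\<le>n. (-1) ^ k * real (n choose k) * real (odd_dfact (n - k)))"

text \<open>Inclusion-exclusion over the sets \<open>I\<close> of edges shared with
  \<open>M\<close>. Every \<open>I \<subseteq> M\<close> is a partial matching, so its contribution
  depends on \<open>card I\<close> alone.\<close>

lemma card_matchings_avoiding:
  assumes V: "finite V" "card V = 2 * n" and M: "M \<in> matchings_on V"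
  shows "real (card {p \<in> matchings_on V. p \<inter> M = {}}) = derangements n"
proof -
  let ?P = "matchings_on V"
  have finP: "finite ?P" by (rule finite_matchings_on[OF V(1)])
  have finM: "finite M" by (rule finite_matching_on[OF V(1) M])
  have cM: "card M = n" by (rule card_perfect_matching[OF V(2) M])
  have "real (card {p \<in> ?P. p \<inter> M = {}}) = (\<Sum>p\<in>?P. if p \<inter> M = {} then 1 else 0)"
    using finP by (simp add: sum.If_cases Int_def)
  also have "\<dots> = (\<Sum>p\<in>?P. \<Sum>I\<in>Pow (p \<inter> M). (-1) ^ card I)"
    using finM by (intro sum.cong refl, subst sum_Pow_alternating) auto
  also have "\<dots> = (\<Sum>p\<in>?P. \<Sum>I | I \<in> Pow M \<and> I \<subseteq> p. (-1) ^ card I)"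
    by (intro sum.cong refl) auto
  also have "\<dots> = (\<Sum>I\<in>Pow M. \<Sum>p | p \<in> ?P \<and> I \<subseteq> p. (-1) ^ card I)"
    using finP finM by (intro sum.swap_restrict) auto
  also have "\<dots> = (\<Sum>I\<in>Pow M. (-1) ^ card I * real (odd_dfact (n - card I)))"
  proof (rule sum.cong[OF refl])
    fix I assume "I \<in> Pow M"
    then have "matching I" "\<Union>I \<subseteq> V" using M by (auto simp: matchings_on_def intro: matching_subset)
    from card_matchings_containing[OF V this]
    show "(\<Sum>p | p \<in> ?P \<and> I \<subseteq> p. (-1) ^ card I) = (-1) ^ card I * real (odd_dfact (n - card I))"
      by simp
  qed
  also have "\<dots> = (\<Sum>k\<le>n. \<Sum>I | I \<in> Pow M \<and> card I = k. (-1) ^ card I * real (odd_dfact (n - card I)))"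
    using finM cM by (intro sum.group[symmetric]) (auto intro: card_mono)
  also have "\<dots> = derangements n"
    unfolding derangements_def
  proof (rule sum.cong[OF refl])
    fix k
    have "(\<Sum>I | I \<in> Pow M \<and> card I = k. (-1) ^ card I * real (odd_dfact (n - card I)))
        = (\<Sum>I | I \<subseteq> M \<and> card I = k. (-1) ^ k * real (odd_dfact (n - k)))"
      by (intro sum.cong) auto
    then show "(\<Sum>I | I \<in> Pow M \<and> card I = k. (-1) ^ card I * real (odd_dfact (n - card I)))
        = (-1) ^ k * real (n choose k) * real (odd_dfact (n - k))"
      using n_subsets[OF finM, of k] cM by simp
  qed
  finally show ?thesis .
qed

lemma card_matchings_containing_avoiding:
  assumes V: "finite V" "card V = 2 * n"
    and U: "matching U" "\<Union>U \<subseteq> V" and m: "m \<in> matchings_on V"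
  shows "derangements (n - card U) \<le> real (card {p \<in> matchings_on V. U \<subseteq> p \<and> p \<inter> (m - U) = {}})"
proof -
  \<comment> \<open>Edges of m touching the vertices of U, but not in U, are avoided automatically.\<close>
  let ?V = "V - \<Union>U"
  have cV: "card ?V = 2 * (n - card U)"
    using V U card_Union_matching[of U] by (subst card_Diff_subset) (auto intro: finite_subset)
  have finV: "finite ?V" using V by simp
  \<comment> \<open>The edges of \<open>m\<close> among the remaining vertices need not cover them.
    Completing them to a perfect matching \<open>M\<close> only adds edges to avoid, whence an
    inequality.\<close>
  have "matching {e \<in> m. e \<subseteq> ?V}" "\<Union>{e \<in> m. e \<subseteq> ?V} \<subseteq> ?V"
    using m by (auto simp: matchings_on_def intro: matching_subset)
  from matching_extends[OF finV cV this] obtain M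
    where M: "M \<in> matchings_on ?V" "{e \<in> m. e \<subseteq> ?V} \<subseteq> M" .
  note bij = bij_betw_matchings_containing[OF U]
  have "derangements (n - card U) = real (card {p \<in> matchings_on ?V. p \<inter> M = {}})"
    using card_matchings_avoiding[OF finV cV M(1)] by simp
  also have "card {p \<in> matchings_on ?V. p \<inter> M = {}} \<le> card {p \<in> matchings_on V. U \<subseteq> p \<and> p \<inter> (m - U) = {}}"
  proof (rule card_inj_on_le)
    show "inj_on (\<lambda>p. p \<union> U) {p \<in> matchings_on ?V. p \<inter> M = {}}"
      using bij by (auto simp: bij_betw_def intro: inj_on_subset)
    show "(\<lambda>p. p \<union> U) ` {p \<in> matchings_on ?V. p \<inter> M = {}} \<subseteq> {p \<in> matchings_on V. U \<subseteq> p \<and> p \<inter> (m - U) = {}}"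
    proof clarify
      fix p assume p: "p \<in> matchings_on ?V" "p \<inter> M = {}"
      have "p \<union> U \<in> {m \<in> matchings_on V. U \<subseteq> m}"
        using bij p(1) by (auto simp: bij_betw_def)
      moreover have "(p \<union> U) \<inter> (m - U) = {}"
      proof -
        have "e \<in> M" if "e \<in> p" "e \<in> m" for e
          using that p(1) M(2) by (auto simp: matchings_on_def)
        then show ?thesis using p(2) by auto
      qed
      ultimately show "p \<union> U \<in> matchings_on V \<and> U \<subseteq> p \<union> U \<and> (p \<union> U) \<inter> (m - U) = {}"
        by simp
    qed
    show "finite {p \<in> matchings_on V. U \<subseteq> p \<and> p \<inter> (m - U) = {}}"
      using finite_matchings_on[OF V(1)] by simp
  qed
  finally show ?thesis by simp
qed

section \<open>Asymptotics of the number of avoiding matchings\<close>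

text \<open>The absolute value of a summand of \<open>derangements n\<close> after division by
  \<open>odd_dfact n\<close>. It vanishes for \<open>k > n\<close>, so the finite sum can be read as
  a series.\<close>

definition derangement_term :: "nat \<Rightarrow> nat \<Rightarrow> real" where
  "derangement_term k n = real (n choose k) * real (odd_dfact (n - k)) / real (odd_dfact n)"

lemma derangement_term_0: "derangement_term 0 n = 1"
  using odd_dfact_pos[of n] by (simp add: derangement_term_def)

lemma derangement_term_nonneg: "derangement_term k n \<ge> 0"
  by (simp add: derangement_term_def)

text \<open>The ratio of consecutive terms yields both the bound and the limit below by induction on
  \<open>k\<close>. For \<open>k \<ge> n\<close> both sides are zero.\<close>

lemma derangement_term_Suc:
  "derangement_term (Suc k) n
    = derangement_term k n * ((real n - real k) / ((2 * (real n - real k) - 1) * real (Suc k)))"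
proof (cases "k < n")
  case True
  then obtain d where d: "n = k + Suc d" using less_iff_Suc_add by auto
  have "real (Suc k) * real (n choose Suc k) = real (n choose k) * real (Suc d)"
  proof -
    have "Suc k * (n choose Suc k) = (n choose k) * (n - k)"
      by (metis binomial_absorption mult.commute binomial_absorb_comp)
    then show ?thesis using d by (metis add_diff_cancel_left' of_nat_mult)
  qed
  then have a: "real (n choose Suc k) = real (n choose k) * (real n - real k) / real (Suc k)"
    using d by (simp add: field_simps)
  have b: "real (odd_dfact (n - k)) = real (odd_dfact (n - Suc k)) * (2 * (real n - real k) - 1)"
    using d by (simp add: odd_dfact_Suc algebra_simps)
  have "2 * (real n - real k) - 1 \<noteq> 0" using d by simp
  moreover have "p * e / s * c / D = p * (c * f) / D * (e / (f * s))" if "f \<noteq> 0" for p e s c f D :: real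
    using that by (simp add: mult_ac)
  ultimately show ?thesis
    unfolding derangement_term_def a b by blast
next
  case False
  then show ?thesis by (cases "k = n") (simp_all add: derangement_term_def binomial_eq_0)
qed

text \<open>For \<open>x = n - k \<ge> 1\<close> the quotient x / (2x - 1) is at most 1, so each
  ratio is at most 1 / (k + 1). The bound is uniform in \<open>n\<close> and summable in
  \<open>k\<close>, as Tannery's theorem requires.\<close>

lemma derangement_term_le: "derangement_term k n \<le> 1 / fact k"
proof (induction k)
  case 0
  then show ?case by (simp add: derangement_term_0)
next
  case (Suc k)
  show ?case
  proof (cases "k < n")
    case True
    then have "(real n - real k) / (2 * (real n - real k) - 1) \<le> 1"
      by (simp add: divide_simps)
    then have "(real n - real k) / ((2 * (real n - real k) - 1) * real (Suc k)) \<le> 1 / real (Suc k)"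
      by (simp add: divide_simps split: if_splits)
    then have "derangement_term (Suc k) n \<le> 1 / fact k * (1 / real (Suc k))"
      unfolding derangement_term_Suc using Suc True derangement_term_nonneg
      by (intro mult_mono) auto
    then show ?thesis by (simp add: field_simps)
  qed (simp add: derangement_term_def binomial_eq_0)
qed

lemma derangement_term_tendsto: "derangement_term k \<longlonglongrightarrow> (1/2) ^ k / fact k"
proof (induction k)
  case 0
  show ?case by (simp add: derangement_term_0 [abs_def])
next
  case (Suc k)
  have "(\<lambda>n. (real n - real k) / (2 * (real n - real k) - 1)) \<longlonglongrightarrow> 1/2"
    by real_asymp
  from tendsto_divide[OF tendsto_mult[OF Suc this] tendsto_const[of "real (Suc k)"]]
  have "(\<lambda>n. derangement_term k n * ((real n - real k) / (2 * (real n - real k) - 1)) / real (Suc k))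
      \<longlonglongrightarrow> (1/2) ^ k / fact k * (1/2) / real (Suc k)"
    by simp
  then show ?case
    by (simp add: derangement_term_Suc[abs_def] field_simps)
qed

text \<open>Tannery's theorem, dominated convergence for series, lets the limit pass inside the sum;
  what results is the exponential series at -1/2.\<close>

lemma derangements_asymp: "(\<lambda>n. derangements n / real (odd_dfact n)) \<longlonglongrightarrow> 1 / sqrt (exp 1)"
proof -
  have "(\<lambda>n. \<Sum>k. (-1) ^ k * derangement_term k n) \<longlonglongrightarrow> (\<Sum>k. (-1) ^ k * ((1/2) ^ k / fact k))"
  proof (rule conjunct2[OF conjunct2[OF tannerys_theorem[where M = "\<lambda>k. 1 / fact k"]]])
    show "(\<lambda>n. (-1) ^ k * derangement_term k n) \<longlonglongrightarrow> (-1) ^ k * ((1/2) ^ k / fact k)" for k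
      by (intro tendsto_intros derangement_term_tendsto)
    show "\<forall>\<^sub>F (k, n) in at_top \<times>\<^sub>F sequentially. norm ((-1) ^ k * derangement_term k n) \<le> 1 / fact k"
      using derangement_term_le derangement_term_nonneg
      by (intro always_eventually) (auto simp: abs_mult power_abs)
    show "summable (\<lambda>k. 1 / fact k :: real)"
      using summable_exp[of "1::real"] by (simp add: field_simps)
  qed simp
  moreover have "(\<Sum>k. (-1) ^ k * derangement_term k n) = derangements n / real (odd_dfact n)" for n
  proof -
    have "(\<Sum>k. (-1) ^ k * derangement_term k n) = (\<Sum>k\<le>n. (-1) ^ k * derangement_term k n)"
      by (rule suminf_finite) (auto simp: derangement_term_def)
    also have "\<dots> = derangements n / real (odd_dfact n)"
      by (simp add: derangements_def derangement_term_def sum_divide_distrib mult.assoc)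
    finally show ?thesis .
  qed
  moreover have "(\<Sum>k. (-1) ^ k * ((1/2) ^ k / fact k)) = 1 / sqrt (exp (1::real))"
  proof -
    have "(\<Sum>k. (-1) ^ k * ((1/2) ^ k / fact k)) = exp (- 1 / 2 :: real)"
      unfolding exp_def by (intro suminf_cong)
        (simp add: power_mult_distrib[symmetric] field_simps scaleR_conv_of_real
           power_divide power_minus[of "1/2"])
    also have "exp (1::real) = exp (1/2) ^ 2" by (simp flip: exp_of_nat_mult)
    then have "sqrt (exp (1::real)) = exp (1/2)" by simp
    then have "exp (- 1 / 2 :: real) = 1 / sqrt (exp (1::real))"
      by (simp add: exp_minus field_simps)
    finally show ?thesis .
  qed
  ultimately show ?thesis by simp
qed

subsection \<open>Spread families and their cores\<close>

text \<open>Nonemptiness is built in, since otherwise the empty family would have every set as a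
  core.\<close>

definition spread :: "real \<Rightarrow> 'a set \<Rightarrow> 'a set set \<Rightarrow> bool" where
  "spread R B G \<longleftrightarrow> finite G \<and> G \<noteq> {} \<and> (\<forall>m\<in>G. B \<subseteq> m) \<and>
     (\<forall>x. x \<notin> B \<longrightarrow> R * real (card {m \<in> G. x \<in> m}) \<le> real (card G))"

text \<open>Greedy enlargement, with \<open>q\<close> bounding the number of steps. While the
  members through \<open>B\<close> are not spread, some element outside \<open>B\<close> lies in
  more than a 1/R fraction of them, and adding it to \<open>B\<close> costs one factor
  \<open>R\<close>.\<close>

lemma ex_spread_or_dense:
  assumes "finite H" "H \<noteq> {}" "R > 0"
  shows "\<exists>B. finite B \<and> real (card H) \<le> R ^ card B * real (card {m \<in> H. B \<subseteq> m}) \<and>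
    (card B = q \<or> card B < q \<and> spread R B {m \<in> H. B \<subseteq> m})"
proof (induction q)
  case 0
  show ?case by (intro exI[of _ "{}"]) simp
next
  case (Suc q)
  let ?G = "\<lambda>B. {m \<in> H. B \<subseteq> m}"
  obtain B where B: "finite B" "real (card H) \<le> R ^ card B * real (card (?G B))"
    "card B = q \<or> card B < q \<and> spread R B (?G B)"
    using Suc.IH by blast
  show ?case
  proof (cases "spread R B (?G B)")
    case True
    then show ?thesis using B by (intro exI[of _ B]) auto
  next
    case False
    then have cB: "card B = q" using B(3) by blast
    have H: "card H > 0" using assms by (simp add: card_gt_0_iff)
    have "?G B \<noteq> {}"
    proof
      assume "?G B = {}"
      then show False using B(2) H by (simp only: card.empty)
    qed
    then obtain x where x: "x \<notin> B" "R * real (card {m \<in> ?G B. x \<in> m}) > real (card (?G B))"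
      using False assms(1) unfolding spread_def by fastforce
    have eq: "{m \<in> ?G B. x \<in> m} = ?G (insert x B)" by auto
    have "real (card H) \<le> R ^ card B * (R * real (card (?G (insert x B))))"
      using B(2) x(2) assms(3) unfolding eq
      by (meson less_imp_le mult_left_mono order_trans zero_le_power)
    then show ?thesis
      using B(1) x(1) cB by (intro exI[of _ "insert x B"]) (simp add: mult_ac)
  qed
qed

text \<open>Union bound: if every member met \<open>X\<close>, then |G| would be at most |X| |G| / R
  < |G|.\<close>

lemma ex_avoiding:
  assumes "finite G" "G \<noteq> {}" "finite X" "real (card X) < R"
    and sp: "\<And>x. x \<in> X \<Longrightarrow> R * real (card {m \<in> G. x \<in> m}) \<le> real (card G)"
  shows "\<exists>m\<in>G. m \<inter> X = {}"
proof (rule ccontr)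
  assume "\<not> ?thesis"
  then have "G = (\<Union>x\<in>X. {m \<in> G. x \<in> m})" by auto
  then have "card G \<le> (\<Sum>x\<in>X. card {m \<in> G. x \<in> m})"
    using card_UN_le[OF assms(3), of "\<lambda>x. {m \<in> G. x \<in> m}"] by simp
  then have "real (card G) \<le> (\<Sum>x\<in>X. real (card {m \<in> G. x \<in> m}))"
    by (metis of_nat_le_iff of_nat_sum)
  moreover have R: "R > 0" using assms(4) by (meson le_less_trans of_nat_0_le_iff)
  ultimately have "R * real (card G) \<le> (\<Sum>x\<in>X. R * real (card {m \<in> G. x \<in> m}))"
    by (simp flip: sum_distrib_left)
  also have "\<dots> \<le> (\<Sum>x\<in>X. real (card G))" by (intro sum_mono sp)
  finally have "R * real (card G) \<le> real (card X) * real (card G)" by simp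
  moreover have "card G > 0" using assms by (simp add: card_gt_0_iff)
  ultimately show False using assms(4) by simp
qed

text \<open>The choices are made in turn: \<open>m\<close> avoids \<open>B' - B\<close>, which
  forces \<open>m \<inter> B' \<subseteq> B\<close>; then \<open>m'\<close> avoids
  \<open>m - B'\<close>, which forces \<open>m \<inter> m' \<subseteq> B'\<close>.\<close>

lemma spread_cores_intersect:
  assumes G: "spread R B G" and G': "spread R B' G'"
    and size: "\<And>m. m \<in> G \<union> G' \<Longrightarrow> finite m \<and> real (card m) < R"
  shows "\<exists>m\<in>G. \<exists>m'\<in>G'. m \<inter> m' \<subseteq> B \<inter> B'"
proof -
  \<comment> \<open>The member \<open>m0\<close> bounds the size of \<open>B' - B\<close> below
    \<open>R\<close>.\<close>
  obtain m0 where m0: "m0 \<in> G'" "B' \<subseteq> m0" using G' unfolding spread_def by blast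
  have "finite (B' - B)" "card (B' - B) \<le> card m0"
    using size[of m0] m0 by (auto intro: finite_subset card_mono)
  then have "\<exists>m\<in>G. m \<inter> (B' - B) = {}"
    using G size[of m0] m0 by (intro ex_avoiding[where R = R]) (auto simp: spread_def)
  then obtain m where m: "m \<in> G" "m \<inter> (B' - B) = {}" by blast
  have "finite (m - B')" "card (m - B') \<le> card m"
    using size[of m] m by (auto intro: card_mono)
  then have "\<exists>m'\<in>G'. m' \<inter> (m - B') = {}"
    using G' size[of m] m by (intro ex_avoiding[where R = R]) (auto simp: spread_def)
  then obtain m' where "m' \<in> G'" "m' \<inter> (m - B') = {}" by blast
  with m show ?thesis by blast
qed

text \<open>In the bound, \<open>q ^ t\<close> counts the \<open>t\<close>-subsets of one fixed
  member, and the further \<open>q\<close> the ways to extend each by an element of a second member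
  not containing it.\<close>

lemma t_intersecting_cover:
  assumes S: "\<And>B. B \<in> S \<Longrightarrow> finite B \<and> card B \<le> q"
    and int: "\<And>B B'. B \<in> S \<Longrightarrow> B' \<in> S \<Longrightarrow> t \<le> card (B \<inter> B')"
    and no_common: "\<And>U. card U = t \<Longrightarrow> \<exists>B\<in>S. \<not> U \<subseteq> B"
  shows "\<exists>W. finite W \<and> card W \<le> q ^ Suc t \<and> (\<forall>w\<in>W. card w = Suc t) \<and> (\<forall>B\<in>S. \<exists>w\<in>W. w \<subseteq> B)"
proof (cases "S = {}")
  case True
  then show ?thesis by (intro exI[of _ "{}"]) simp
next
  case False
  then obtain B0 where B0: "B0 \<in> S" by blast
  have fB0: "finite B0" "card B0 \<le> q" "t \<le> card B0" using S[OF B0] int[OF B0 B0] by auto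
  define C where "C = {U. U \<subseteq> B0 \<and> card U = t}"
  have finC: "finite C" using fB0 by (simp add: C_def)
  have "card C = card B0 choose t" unfolding C_def by (rule n_subsets[OF fB0(1)])
  also have "\<dots> \<le> card B0 ^ t" by (rule binomial_le_pow[OF fB0(3)])
  also have "\<dots> \<le> q ^ t" using fB0 by (intro power_mono) auto
  finally have cC: "card C \<le> q ^ t" .
  \<comment> \<open>A member meets B0 in some t-set U; since it also meets b U in at least t elements, it contains
    an element of b U - U.\<close>
  define b where "b U = (SOME B. B \<in> S \<and> \<not> U \<subseteq> B)" for U
  have b: "b U \<in> S \<and> \<not> U \<subseteq> b U" if "U \<in> C" for U
  proof -
    have "\<exists>B. B \<in> S \<and> \<not> U \<subseteq> B" using no_common[of U] that by (auto simp: C_def)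
    then show ?thesis unfolding b_def by (rule someI_ex)
  qed
  define W where "W = (\<Union>U\<in>C. (\<lambda>x. insert x U) ` (b U - U))"
  show ?thesis
  proof (intro exI[of _ W] conjI ballI)
    show "finite W" unfolding W_def using finC b S by auto
    have "card W \<le> (\<Sum>U\<in>C. card ((\<lambda>x. insert x U) ` (b U - U)))"
      unfolding W_def by (rule card_UN_le[OF finC])
    also have "\<dots> \<le> (\<Sum>U\<in>C. q)"
    proof (rule sum_mono)
      fix U assume "U \<in> C"
      then have bU: "finite (b U)" "card (b U) \<le> q" using b S by auto
      have "card ((\<lambda>x. insert x U) ` (b U - U)) \<le> card (b U - U)"
        using bU by (intro card_image_le) simp
      also have "\<dots> \<le> card (b U)" using bU by (intro card_mono) auto
      finally show "card ((\<lambda>x. insert x U) ` (b U - U)) \<le> q" using bU by simp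
    qed
    also have "\<dots> \<le> q ^ Suc t" using cC by (simp add: mult.commute)
    finally show "card W \<le> q ^ Suc t" .
    show "card w = Suc t" if "w \<in> W" for w
      using that finite_subset[OF _ fB0(1)] by (auto simp: W_def C_def)
    show "\<exists>w\<in>W. w \<subseteq> B" if B: "B \<in> S" for B
    proof -
      obtain U where U: "U \<subseteq> B \<inter> B0" "card U = t"
        using int[OF B B0] by (meson obtain_subset_with_card_n)
      then have UC: "U \<in> C" by (auto simp: C_def)
      note bU = b[OF UC]
      have finU: "finite U" using U fB0 by (auto intro: finite_subset)
      have "card (U \<inter> b U) < t"
        using bU U(2) finU by (metis inf.absorb_iff1 inf_le1 psubsetI psubset_card_mono)
      moreover have "t \<le> card (B \<inter> b U)" using int B bU by blast
      ultimately have "\<not> B \<inter> b U \<subseteq> U \<inter> b U"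
        using finU by (metis card_mono finite_Int leD order_trans)
      then obtain x where "x \<in> B" "x \<in> b U - U" by blast
      then show ?thesis using UC U(1) by (intro bexI[of _ "insert x U"]) (auto simp: W_def)
    qed
  qed
qed

subsection \<open>Error terms\<close>

text \<open>Each of the \<open>j\<close> further factors is at least \<open>2 * k\<close>.\<close>

lemma odd_dfact_add_ge: "odd_dfact k * (2 * k) ^ j \<le> odd_dfact (k + j)"
proof (induction j)
  case (Suc j)
  have "odd_dfact k * (2 * k) ^ Suc j = (odd_dfact k * (2 * k) ^ j) * (2 * k)" by simp
  also have "\<dots> \<le> odd_dfact (k + j) * (2 * (k + j) + 1)"
    using Suc by (intro mult_mono) auto
  finally show ?case by (simp add: odd_dfact_Suc)
qed simp

text \<open>\<open>q\<close> is the integer part of the \<open>t\<close>-th root of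
  \<open>n\<close>, found as the predecessor of the least \<open>p\<close> with
  \<open>n < p ^ t\<close>.\<close>

lemma ex_nat_root:
  fixes n t :: nat
  assumes "t > 0" "q0 ^ t \<le> n"
  obtains q where "q \<ge> q0" "q ^ t \<le> n" "n < (q + 1) ^ t"
proof -
  have "n < (n + 1) ^ t"
    using assms(1) self_le_power[of "n + 1" t] by linarith
  from ex_least_nat_le[of "\<lambda>p. n < p ^ t", OF this]
  obtain p where p: "\<forall>i<p. \<not> n < i ^ t" "n < p ^ t" by blast
  have "p > q0"
  proof (rule ccontr)
    assume "\<not> p > q0"
    then have "p ^ t \<le> q0 ^ t" by (intro power_mono) auto
    then show False using p(2) assms(2) by simp
  qed
  then show ?thesis using p that[of "p - 1"] by (simp add: not_less)
qed

text \<open>The witness \<open>q\<close> is the integer part of the root of \<open>n\<close> of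
  order \<open>t + 2\<close>. Then \<open>q ^ Suc t\<close> is at most n / q, while fixed powers of
  \<open>n\<close> are polynomially bounded in \<open>q\<close> and lose against the exponential
  \<open>(4/5) ^ q\<close>.\<close>

lemma error_terms_small:
  fixes \<delta> :: real and t :: nat
  assumes "\<delta> > 0"
  shows "\<exists>n0. \<forall>n>n0. \<exists>q. (3 * real n / 2) ^ q * real (odd_dfact (n - q)) \<le> \<delta> * real (odd_dfact (n - t))
    \<and> real (q ^ Suc t) * real (odd_dfact (n - Suc t)) \<le> \<delta> * real (odd_dfact (n - t))"
proof -
  \<comment> \<open>Here \<open>2 * (q + 1) ^ (t + 2)\<close> will dominate
    \<open>3 * n / 2\<close>, and \<open>(5/4) ^ t\<close> corrects for the true exponent of 4/5,
    which is \<open>q - t\<close>.\<close>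
  have "(\<lambda>q. (4/5) ^ q * (5/4) ^ t * (2 * (real q + 1) ^ (t + 2)) ^ t :: real) \<longlonglongrightarrow> 0"
    by real_asymp
  then have "\<forall>\<^sub>F q in sequentially. (4/5) ^ q * (5/4) ^ t * (2 * (real q + 1) ^ (t + 2)) ^ t < \<delta>"
    using assms by (rule order_tendstoD)
  moreover have "\<forall>\<^sub>F q in sequentially. 1 / \<delta> \<le> real q"
    by (metis eventually_sequentiallyI nat_ceiling_le_eq)
  \<comment> \<open>\<open>1 / \<delta> \<le> q\<close> serves the second estimate,
    \<open>q \<ge> 16\<close> gives \<open>16 * q \<le> q ^ 2 \<le> n\<close>, and
    \<open>q \<ge> 2 * t + 1\<close> gives \<open>t \<le> q\<close> and
    \<open>2 * t + 1 \<le> n\<close>.\<close>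
  ultimately have "\<forall>\<^sub>F q in sequentially. (4/5) ^ q * (5/4) ^ t * (2 * (real q + 1) ^ (t + 2)) ^ t < \<delta>
      \<and> 1 / \<delta> \<le> real q \<and> q \<ge> 16 \<and> q \<ge> 2 * t + 1"
    by (intro eventually_conj eventually_ge_at_top)
  then obtain q0 where q0: "\<And>q. q \<ge> q0 \<Longrightarrow> (4/5) ^ q * (5/4) ^ t * (2 * (real q + 1) ^ (t + 2)) ^ t < \<delta>
      \<and> 1 / \<delta> \<le> real q \<and> q \<ge> 16 \<and> q \<ge> 2 * t + 1"
    by (auto simp: eventually_sequentially)
  show ?thesis
  proof (rule exI[of _ "q0 ^ (t + 2)"], intro allI impI)
    fix n assume "n > q0 ^ (t + 2)"
    then obtain q where q: "q \<ge> q0" "q ^ (t + 2) \<le> n" "n < (q + 1) ^ (t + 2)"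
      using ex_nat_root[of "t + 2" q0 n] by auto
    note Q = q0[OF q(1)]
    have "16 * q \<le> q ^ 2" using Q by (simp add: power2_eq_square)
    also have "\<dots> \<le> q ^ (t + 2)" using Q by (intro power_increasing) auto
    finally have qn: "16 * q \<le> n" using q(2) by linarith
    have "(3 * real n / 2) ^ q * real (odd_dfact (n - q)) \<le> \<delta> * real (odd_dfact (n - t))"
    proof -
      have "(3 * real n / 2) ^ t \<le> (2 * (real q + 1) ^ (t + 2)) ^ t"
      proof (rule power_mono)
        have "real n \<le> real ((q + 1) ^ (t + 2))" using q(3) by linarith
        also have "\<dots> = (real q + 1) ^ (t + 2)" by (simp only: of_nat_power of_nat_add of_nat_1)
        finally have "real n \<le> (real q + 1) ^ (t + 2)" .
        then show "3 * real n / 2 \<le> 2 * (real q + 1) ^ (t + 2)"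
          using of_nat_0_le_iff[of n] by linarith
      qed simp
      then have "(4/5) ^ q * (5/4) ^ t * (3 * real n / 2) ^ t \<le> (4/5) ^ q * (5/4) ^ t * (2 * (real q + 1) ^ (t + 2)) ^ t"
        by (intro mult_left_mono) auto
      then have small: "(4/5) ^ q * (5/4) ^ t * (3 * real n / 2) ^ t \<le> \<delta>" using Q by linarith
      obtain d where d: "q = d + t" using Q that[of "q - t"] by linarith
      have "(4/5::real) ^ q * (5/4) ^ t = (4/5) ^ d"
      proof -
        have "(4/5::real) ^ q * (5/4) ^ t = (4/5) ^ d * ((4/5) * (5/4)) ^ t"
          by (simp only: d power_add power_mult_distrib mult.assoc)
        then show ?thesis by simp
      qed
      \<comment> \<open>The constants come from 3/2 = (4/5) (15/8); \<open>15 / 8 * n\<close> is at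
        most \<open>2 * (n - q)\<close> because \<open>16 * q \<le> n\<close>.\<close>
      then have "(3 * real n / 2) ^ q = ((4/5) ^ q * (5/4) ^ t * (3 * real n / 2) ^ t) * (15 / 8 * real n) ^ d"
      proof -
        have "(3 * real n / 2) ^ q = ((4/5) * (15 / 8 * real n)) ^ d * (3 * real n / 2) ^ t"
          by (simp add: d power_add)
        then show ?thesis using \<open>(4/5::real) ^ q * (5/4) ^ t = (4/5) ^ d\<close>
          by (simp only: power_mult_distrib mult_ac)
      qed
      also have "\<dots> \<le> \<delta> * (15 / 8 * real n) ^ d"
        by (intro mult_right_mono small) simp
      also have "\<dots> \<le> \<delta> * (real (2 * (n - q))) ^ d"
        using qn assms by (intro mult_left_mono power_mono) (auto simp: of_nat_diff)
      finally have "(3 * real n / 2) ^ q * real (odd_dfact (n - q))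
          \<le> \<delta> * (real (2 * (n - q))) ^ d * real (odd_dfact (n - q))"
        by (intro mult_right_mono) auto
      also have "\<dots> = \<delta> * real (odd_dfact (n - q) * (2 * (n - q)) ^ d)" by simp
      also have "\<dots> \<le> \<delta> * real (odd_dfact (n - q + d))"
        using odd_dfact_add_ge assms by (intro mult_left_mono) (auto simp del: of_nat_mult)
      also have "n - q + d = n - t" using d qn by simp
      finally show ?thesis .
    qed
    moreover have "real (q ^ Suc t) * real (odd_dfact (n - Suc t)) \<le> \<delta> * real (odd_dfact (n - t))"
    proof -
      have tn: "2 * t + 1 \<le> n" using Q qn by linarith
      then have "n - t = Suc (n - Suc t)" by simp
      then have e: "odd_dfact (n - t) = odd_dfact (n - Suc t) * (2 * (n - Suc t) + 1)"
        by (metis odd_dfact_Suc)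
      have "q ^ (t + 2) \<le> 2 * (n - Suc t) + 1" using q(2) tn by linarith
      then have q2: "real (q ^ (t + 2)) \<le> real (2 * (n - Suc t) + 1)" by (simp only: of_nat_le_iff)
      have "1 \<le> \<delta> * real q" using Q assms by (simp add: field_simps)
      then have "real (q ^ Suc t) * 1 \<le> real (q ^ Suc t) * (\<delta> * real q)" by (intro mult_left_mono) auto
      also have "\<dots> = \<delta> * real (q ^ (t + 2))" by simp
      also have "\<dots> \<le> \<delta> * real (2 * (n - Suc t) + 1)"
        using q2 assms by (intro mult_left_mono) auto
      finally have "real (q ^ Suc t) \<le> \<delta> * real (2 * (n - Suc t) + 1)" by simp
      from mult_right_mono[OF this of_nat_0_le_iff[of "odd_dfact (n - Suc t)"]]
      show ?thesis unfolding e by (simp only: of_nat_mult mult_ac)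
    qed
    ultimately show "\<exists>q. (3 * real n / 2) ^ q * real (odd_dfact (n - q)) \<le> \<delta> * real (odd_dfact (n - t))
      \<and> real (q ^ Suc t) * real (odd_dfact (n - Suc t)) \<le> \<delta> * real (odd_dfact (n - t))" by blast
  qed
qed

subsection \<open>Large t-intersecting families\<close>

text \<open>If the greedy enlargement reached \<open>q\<close> elements, the bound on the matchings
  through a \<open>q\<close>-element set would contradict \<open>big\<close>.\<close>

lemma ex_spread_core:
  assumes V: "finite V" "card V = 2 * n" and "n > 0" and H: "H \<subseteq> matchings_on V"
    and big: "(3 * real n / 2) ^ q * real (odd_dfact (n - q)) < real (card H)"
  shows "\<exists>B. finite B \<and> card B < q \<and> spread (3 * real n / 2) B {m \<in> H. B \<subseteq> m}"
proof -
  let ?R = "3 * real n / 2"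
  have fH: "finite H" using H finite_matchings_on[OF V(1)] by (rule finite_subset)
  have "H \<noteq> {}"
  proof
    assume "H = {}"
    then have "(3 * real n / 2) ^ q * real (odd_dfact (n - q)) < 0" using big by simp
    moreover have "(3 * real n / 2) ^ q * real (odd_dfact (n - q)) \<ge> 0" by (intro mult_nonneg_nonneg) auto
    ultimately show False by linarith
  qed
  then obtain B where B: "finite B" "real (card H) \<le> ?R ^ card B * real (card {m \<in> H. B \<subseteq> m})"
    "card B = q \<or> card B < q \<and> spread ?R B {m \<in> H. B \<subseteq> m}"
    using ex_spread_or_dense[OF fH, of ?R q] \<open>n > 0\<close> by auto
  have "card B \<noteq> q"
  proof
    assume cB: "card B = q"
    have "card {m \<in> H. B \<subseteq> m} \<le> card {m \<in> matchings_on V. B \<subseteq> m}"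
      using H finite_matchings_on[OF V(1)] by (intro card_mono) auto
    also have "\<dots> \<le> odd_dfact (n - q)" using card_matchings_containing_le[OF V, of B] cB by simp
    finally have "?R ^ q * real (card {m \<in> H. B \<subseteq> m}) \<le> ?R ^ q * real (odd_dfact (n - q))"
      by (intro mult_left_mono) auto
    then show False using B(2) big cB by simp
  qed
  then show ?thesis using B by blast
qed

text \<open>The alternatives correspond to whether or not the cores of fewer than \<open>q\<close>
  edges have a common set of size \<open>t\<close>.\<close>

lemma t_intersecting_approx:
  assumes V: "finite V" "card V = 2 * n" and n: "n > 0"
    and F: "F \<subseteq> matchings_on V" and int: "t_intersecting t F"
  shows "(\<exists>U. card U = t \<and> real (card {m \<in> F. \<not> U \<subseteq> m}) \<le> (3 * real n / 2) ^ q * real (odd_dfact (n - q)))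
    \<or> real (card F) \<le> (3 * real n / 2) ^ q * real (odd_dfact (n - q)) + real (q ^ Suc t) * real (odd_dfact (n - Suc t))"
proof -
  let ?R = "3 * real n / 2"
  \<comment> \<open>\<open>S\<close> collects the cores of all spread subfamilies of
    \<open>F\<close>. Hence a spread subfamily found inside \<open>H\<close> has its core in
    \<open>S\<close>, against the definition of \<open>H\<close>; so \<open>H\<close> is
    small.\<close>
  define S where "S = {B. finite B \<and> card B < q \<and> (\<exists>G\<subseteq>F. spread ?R B G)}"
  define H where "H = {m \<in> F. \<not> (\<exists>B\<in>S. B \<subseteq> m)}"
  have fF: "finite F" using F finite_matchings_on[OF V(1)] by (rule finite_subset)
  have HF: "H \<subseteq> F" by (auto simp: H_def)
  have cH: "real (card H) \<le> ?R ^ q * real (odd_dfact (n - q))"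
  proof (rule ccontr)
    assume "\<not> ?thesis"
    then obtain B where B: "finite B" "card B < q" "spread ?R B {m \<in> H. B \<subseteq> m}"
      using ex_spread_core[OF V n _, of H q] HF F by (meson not_le order_trans)
    moreover have "{m \<in> H. B \<subseteq> m} \<subseteq> F" using HF by blast
    ultimately have "B \<in> S" unfolding S_def by blast
    moreover have "{m \<in> H. B \<subseteq> m} \<noteq> {}" using B(3) by (simp add: spread_def)
    ultimately show False by (auto simp: H_def)
  qed
  have intS: "t \<le> card (B \<inter> B')" if "B \<in> S" "B' \<in> S" for B B'
  proof -
    obtain G where "G \<subseteq> F" "spread ?R B G" using \<open>B \<in> S\<close> unfolding S_def by blast
    moreover obtain G' where "G' \<subseteq> F" "spread ?R B' G'" using \<open>B' \<in> S\<close> unfolding S_def by blast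
    ultimately have G: "G \<subseteq> F" "spread ?R B G" "G' \<subseteq> F" "spread ?R B' G'" by auto
    \<comment> \<open>Members have exactly \<open>n\<close> edges, and \<open>n < 3 * n / 2\<close>
      since \<open>n > 0\<close>.\<close>
    have "finite m \<and> real (card m) < ?R" if "m \<in> G \<union> G'" for m
    proof -
      have m: "m \<in> matchings_on V" using that G(1,3) F by auto
      show ?thesis
        using card_perfect_matching[OF V(2) m] finite_matching_on[OF V(1) m] n by simp
    qed
    from spread_cores_intersect[OF G(2,4) this]
    obtain m m' where m: "m \<in> G" "m' \<in> G'" "m \<inter> m' \<subseteq> B \<inter> B'" by blast
    then have "t \<le> card (m \<inter> m')" using int G by (auto simp: t_intersecting_def)
    also have "\<dots> \<le> card (B \<inter> B')" using m(3) that by (intro card_mono) (auto simp: S_def)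
    finally show ?thesis .
  qed
  show ?thesis
  proof (cases "\<exists>U. card U = t \<and> (\<forall>B\<in>S. U \<subseteq> B)")
    case True
    then obtain U where U: "card U = t" "\<forall>B\<in>S. U \<subseteq> B" by blast
    \<comment> \<open>A member without \<open>U\<close> contains no core, because \<open>U\<close>
      lies in all of them.\<close>
    then have "card {m \<in> F. \<not> U \<subseteq> m} \<le> card H"
      using fF by (intro card_mono) (auto simp: H_def)
    then show ?thesis using U cH by (intro disjI1 exI[of _ U]) auto
  next
    case False
    have "\<exists>W. finite W \<and> card W \<le> q ^ Suc t \<and> (\<forall>w\<in>W. card w = Suc t) \<and> (\<forall>B\<in>S. \<exists>w\<in>W. w \<subseteq> B)"
    proof (rule t_intersecting_cover)
      show "finite B \<and> card B \<le> q" if "B \<in> S" for B using that by (auto simp: S_def)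
    qed (use intS False in auto)
    then obtain W where W: "finite W" "card W \<le> q ^ Suc t" "\<forall>w\<in>W. card w = Suc t" "\<forall>B\<in>S. \<exists>w\<in>W. w \<subseteq> B"
      by blast
    let ?C = "\<lambda>w. {m \<in> matchings_on V. w \<subseteq> m}"
    have "F \<subseteq> H \<union> (\<Union>w\<in>W. ?C w)"
    proof
      fix m assume m: "m \<in> F"
      show "m \<in> H \<union> (\<Union>w\<in>W. ?C w)"
      proof (cases "m \<in> H")
        case False
        then obtain B where "B \<in> S" "B \<subseteq> m" using m by (auto simp: H_def)
        then obtain w where "w \<in> W" "w \<subseteq> B" using W(4) by blast
        then have "w \<in> W" "m \<in> ?C w" using \<open>B \<subseteq> m\<close> m F by auto
        then show ?thesis by blast
      qed simp
    qed
    then have "card F \<le> card (H \<union> (\<Union>w\<in>W. ?C w))"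
      using fF W(1) finite_matchings_on[OF V(1)] by (intro card_mono) (auto simp: H_def)
    also have "\<dots> \<le> card H + card (\<Union>w\<in>W. ?C w)" by (rule card_Un_le)
    also have "card (\<Union>w\<in>W. ?C w) \<le> (\<Sum>w\<in>W. card (?C w))" by (rule card_UN_le[OF W(1)])
    also have "\<dots> \<le> (\<Sum>w\<in>W. odd_dfact (n - Suc t))"
      using card_matchings_containing_le[OF V] W(3) by (intro sum_mono) metis
    also have "\<dots> \<le> q ^ Suc t * odd_dfact (n - Suc t)" using W(2) by simp
    finally have "card F \<le> card H + q ^ Suc t * odd_dfact (n - Suc t)" by simp
    then have "real (card F) \<le> real (card H) + real (q ^ Suc t) * real (odd_dfact (n - Suc t))"
      by (metis of_nat_add of_nat_le_iff of_nat_mult)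
    then show ?thesis using cH by linarith
  qed
qed

text \<open>\<open>m\<close> has fewer than \<open>t\<close> edges in \<open>U\<close>, so a member
  of \<open>F\<close> through \<open>U\<close> must contain an edge of \<open>m - U\<close>. At
  least \<open>derangements (n - t)\<close> perfect matchings through \<open>U\<close> do not, and
  these are missing from \<open>F\<close>.\<close>

lemma card_canonical_part_le:
  assumes V: "finite V" "card V = 2 * n"
    and F: "F \<subseteq> matchings_on V" and int: "t_intersecting t F"
    and U: "matching U" "\<Union>U \<subseteq> V" "card U = t" and m: "m \<in> F" "\<not> U \<subseteq> m"
  shows "real (card {p \<in> F. U \<subseteq> p}) + derangements (n - t) \<le> real (odd_dfact (n - t))"
proof -
  let ?A = "{p \<in> F. U \<subseteq> p}" and ?D = "{p \<in> matchings_on V. U \<subseteq> p \<and> p \<inter> (m - U) = {}}"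
  have mV: "m \<in> matchings_on V" using m F by auto
  have finU: "finite U" using U(2) V(1) by (auto intro: finite_UnionD finite_subset)
  have fP: "finite (matchings_on V)" by (rule finite_matchings_on[OF V(1)])
  have "p \<notin> ?D" if p: "p \<in> ?A" for p
  proof
    assume "p \<in> ?D"
    then have "m \<inter> p \<subseteq> m \<inter> U" by auto
    then have "card (m \<inter> p) \<le> card (m \<inter> U)" using finU by (intro card_mono) auto
    also have "\<dots> < card U" using m(2) finU by (intro psubset_card_mono) auto
    finally have "card (m \<inter> p) < t" using U(3) by simp
    moreover have "t \<le> card (m \<inter> p)" using int p m(1) by (simp add: t_intersecting_def)
    ultimately show False by simp
  qed
  then have disj: "?A \<inter> ?D = {}" by blast
  have "card ?A + card ?D = card (?A \<union> ?D)"
    using fP F disj by (intro card_Un_disjoint[symmetric]) (auto intro: finite_subset)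
  also have "\<dots> \<le> card {p \<in> matchings_on V. U \<subseteq> p}"
    using fP F by (intro card_mono) auto
  also have "\<dots> = odd_dfact (n - t)" using card_matchings_containing[OF V U(1,2)] U(3) by simp
  finally have "real (card ?A) + real (card ?D) \<le> real (odd_dfact (n - t))" by linarith
  moreover have "derangements (n - t) \<le> real (card ?D)"
    using card_matchings_containing_avoiding[OF V U(1,2) mV] U(3) by simp
  ultimately show ?thesis by linarith
qed

theorem mainTheorem8:
  fixes t :: nat
  shows "\<forall>\<epsilon>::real. 0 < \<epsilon> \<and> \<epsilon> < 1 / sqrt (exp 1) \<longrightarrow>
    (\<exists>n0::nat. \<forall>n>n0. \<forall>F. F \<subseteq> perfect_matchings n \<and> t_intersecting t F \<and>
       real (card F) > (1 - 1 / sqrt (exp 1) + \<epsilon>) * real (odd_dfact (n - t)) \<longrightarrow>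
       (\<exists>T. T \<subseteq> edges_K (2*n) \<and> card T = t \<and>
            (\<forall>e\<in>T. \<forall>f\<in>T. e \<noteq> f \<longrightarrow> e \<inter> f = {}) \<and>
            (\<forall>m\<in>F. T \<subseteq> m)))"
proof (intro allI impI)
  fix \<epsilon> :: real assume \<epsilon>: "0 < \<epsilon> \<and> \<epsilon> < 1 / sqrt (exp 1)"
  \<comment> \<open>Of the three parts of \<epsilon>, one pays for the members without
    \<open>U\<close>, one for the deviation of \<open>derangements\<close> from its limit, and one
    stays as slack.\<close>
  define \<delta> where "\<delta> = \<epsilon> / 3"
  have \<delta>: "\<delta> > 0" using \<epsilon> by (simp add: \<delta>_def)
  let ?c = "1 / sqrt (exp 1) :: real"
  have c1: "?c < 1" by simp
  have "\<forall>\<^sub>F n in sequentially. ?c - \<delta> < derangements n / real (odd_dfact n)"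
    using \<delta> by (intro order_tendstoD(1)[OF derangements_asymp]) simp
  then obtain n1 where n1: "\<And>n. n \<ge> n1 \<Longrightarrow> ?c - \<delta> < derangements n / real (odd_dfact n)"
    by (auto simp: eventually_sequentially)
  obtain n2 where n2: "\<And>n. n > n2 \<Longrightarrow> \<exists>q. (3 * real n / 2) ^ q * real (odd_dfact (n - q)) \<le> \<delta> * real (odd_dfact (n - t))
    \<and> real (q ^ Suc t) * real (odd_dfact (n - Suc t)) \<le> \<delta> * real (odd_dfact (n - t))"
    using error_terms_small[OF \<delta>, of t] by blast
  show "\<exists>n0::nat. \<forall>n>n0. \<forall>F. F \<subseteq> perfect_matchings n \<and> t_intersecting t F \<and>
       real (card F) > (1 - 1 / sqrt (exp 1) + \<epsilon>) * real (odd_dfact (n - t)) \<longrightarrow>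
       (\<exists>T. T \<subseteq> edges_K (2*n) \<and> card T = t \<and>
            (\<forall>e\<in>T. \<forall>f\<in>T. e \<noteq> f \<longrightarrow> e \<inter> f = {}) \<and>
            (\<forall>m\<in>F. T \<subseteq> m))"
  \<comment> \<open>This threshold ensures \<open>n - t \<ge> n1\<close>, \<open>n > n2\<close> and
    \<open>n > 0\<close>.\<close>
  proof (intro exI[of _ "n1 + n2 + t"] allI impI)
    fix n F
    assume n: "n > n1 + n2 + t"
      and "F \<subseteq> perfect_matchings n \<and> t_intersecting t F \<and>
       real (card F) > (1 - 1 / sqrt (exp 1) + \<epsilon>) * real (odd_dfact (n - t))"
    then have F: "F \<subseteq> matchings_on {0..<2*n}" and int: "t_intersecting t F"
      and big: "real (card F) > (1 - ?c + \<epsilon>) * real (odd_dfact (n - t))"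
      by (auto simp: perfect_matchings_eq)
    let ?d = "real (odd_dfact (n - t))"
    have d: "?d > 0" using odd_dfact_pos by simp
    have V: "finite {0..<2*n}" "card {0..<2*n} = 2 * n" by auto
    have fF: "finite F" using F finite_matchings_on[OF V(1)] by (rule finite_subset)
    obtain q where q: "(3 * real n / 2) ^ q * real (odd_dfact (n - q)) \<le> \<delta> * ?d"
      "real (q ^ Suc t) * real (odd_dfact (n - Suc t)) \<le> \<delta> * ?d"
      using n2[of n] n by auto
    have eps: "\<epsilon> * ?d = 3 * (\<delta> * ?d)" by (simp add: \<delta>_def)
    have dd: "\<delta> * ?d > 0" "(1 - ?c) * ?d > 0" using \<delta> d c1 by (simp_all only: mult_pos_pos diff_gt_0_iff_gt)
    have big': "real (card F) > (1 - ?c) * ?d + 3 * (\<delta> * ?d)"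
      using big unfolding eps[symmetric] by (simp only: distrib_right)
    \<comment> \<open>The second alternative would cap \<open>card F\<close> at
      \<open>2 * (\<delta> * ?d)\<close>, below the bound in \<open>big'\<close>.\<close>
    have "\<not> real (card F) \<le> (3 * real n / 2) ^ q * real (odd_dfact (n - q))
        + real (q ^ Suc t) * real (odd_dfact (n - Suc t))"
      using q dd big' by linarith
    then obtain U where U: "card U = t"
      "real (card {m \<in> F. \<not> U \<subseteq> m}) \<le> (3 * real n / 2) ^ q * real (odd_dfact (n - q))"
      using t_intersecting_approx[OF V _ F int, of q] n by auto
    have "F = {m \<in> F. U \<subseteq> m} \<union> {m \<in> F. \<not> U \<subseteq> m}" by auto
    then have "card F \<le> card {m \<in> F. U \<subseteq> m} + card {m \<in> F. \<not> U \<subseteq> m}"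
      by (metis card_Un_le)
    then have part: "real (card {m \<in> F. U \<subseteq> m}) > (1 - ?c) * ?d + 2 * (\<delta> * ?d)"
      using big' U(2) q(1) by linarith
    \<comment> \<open>So far \<open>U\<close> is only a set of cardinality \<open>t\<close>; lying
      in a perfect matching makes it a set of disjoint edges of the complete graph.\<close>
    have "{m \<in> F. U \<subseteq> m} \<noteq> {}"
    proof
      assume "{m \<in> F. U \<subseteq> m} = {}"
      then show False using part dd by (simp only: card.empty)
    qed
    then obtain m0 where m0: "m0 \<in> F" "U \<subseteq> m0" by blast
    have m0': "m0 \<in> perfect_matchings n" "m0 \<in> matchings_on {0..<2*n}"
      using m0 F by (auto simp: perfect_matchings_eq)
    have Um: "matching U" "\<Union>U \<subseteq> {0..<2*n}"
      using m0 m0'(2) by (auto simp: matchings_on_def intro: matching_subset)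
    \<comment> \<open>A member missing \<open>U\<close> would cap the members through
      \<open>U\<close> at \<open>(1 - ?c) * ?d + \<delta> * ?d\<close>, which contradicts
      \<open>part\<close>.\<close>
    have all: "U \<subseteq> m" if m: "m \<in> F" for m
    proof (rule ccontr)
      assume "\<not> U \<subseteq> m"
      note le = card_canonical_part_le[OF V F int Um U(1) m this]
      have "?c - \<delta> < derangements (n - t) / ?d" using n1[of "n - t"] n by simp
      then have "(?c - \<delta>) * ?d < derangements (n - t)" using d by (simp only: pos_less_divide_eq)
      then have "?c * ?d - \<delta> * ?d < derangements (n - t)" by (simp only: left_diff_distrib)
      moreover have "(1 - ?c) * ?d = ?d - ?c * ?d" by (simp only: left_diff_distrib mult_1)
      ultimately show False using le part dd by linarith
    qed
    show "\<exists>T. T \<subseteq> edges_K (2*n) \<and> card T = t \<and>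
            (\<forall>e\<in>T. \<forall>f\<in>T. e \<noteq> f \<longrightarrow> e \<inter> f = {}) \<and>
            (\<forall>m\<in>F. T \<subseteq> m)"
    proof (intro exI[of _ U] conjI ballI impI)
      show "U \<subseteq> edges_K (2*n)" using m0(2) m0'(1) by (auto simp: perfect_matchings_def)
      show "e \<inter> f = {}" if "e \<in> U" "f \<in> U" "e \<noteq> f" for e f
        using pairwiseD(1)[of disjnt U e f] Um(1) that by (simp add: matching_def disjnt_def)
    qed (use U(1) all in auto)
  qed
qed

end
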